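(* Let $p$ be a prime and $q$ a power of $p$. (i) If $q>2$ and $i\ge 1$ is an integer, then $g_{q^{2i}-q-1,q}\equiv (i-1)x^{q^2-q-1}-i\,x^{q-2}\pmod{x^{q^2}-x}$. (ii) If $q$ is odd, then $x^{q^2-q-1}+x^{q-2}$ is a permutation polynomial of $\mathbb{F}_{q^2}$ if and only if $q\equiv 1\pmod 4$. (iii) If $q$ is odd, then $g_{q^{p+1}-q-1,q}$ is a permutation polynomial of $\mathbb{F}_{q^2}$ if and only if $q\equiv 1\pmod 4$.
   Context: For a prime $p$, a power $q$ of $p$ and an integer $n\ge 0$, $g_{n,q}\in\mathbb{F}_p[x]$ is the unique polynomial with $\sum_{a\in\mathbb{F}_q}(x+a)^n=g_{n,q}(x^q-x)$. A permutation polynomial of a finite field $\mathbb{F}$ is a polynomial inducing a bijection of $\mathbb{F}$. *)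

theory Defs
  imports "HOL-Number_Theory.Cong" "Berlekamp_Zassenhaus.Finite_Field"
begin

text \<open>
  The prime field with p elements is \<^typ>\<open>'p mod_ring\<close>, where \<^term>\<open>CARD('p::prime_card)\<close> is p;
  a finite field of order q is any type of class \<^class>\<open>finite_field\<close> with exactly q elements.
\<close>

text \<open>
  The canonical map from the prime field into a ring.  It is a ring homomorphism exactly when p
  vanishes in the target, e.g. in a field of order p^e.
\<close>

definition of_prime_field :: "'p::prime_card mod_ring \<Rightarrow> 'a::ring_1" where
  "of_prime_field c = of_int (to_int_mod_ring c)"

abbreviation lift_poly :: "'p::prime_card mod_ring poly \<Rightarrow> 'a::comm_ring_1 poly" where
  "lift_poly \<equiv> map_poly of_prime_field"

text \<open>
  The polynomial g_{n,q}, where q is the order of the finite field \<open>'f\<close>.  Its coefficients are in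
  the prime field, but the defining identity lives over \<open>'f\<close>.  The description is only meaningful
  if \<open>'f\<close> has characteristic \<^term>\<open>CARD('p)\<close>.
\<close>

definition g_poly :: "'f::finite_field itself \<Rightarrow> nat \<Rightarrow> 'p::prime_card mod_ring poly" where
  "g_poly _ n = (THE g. (\<Sum>a\<in>(UNIV :: 'f set). [:a, 1:] ^ n) =
                     pcompose (lift_poly g) (monom 1 CARD('f) - monom 1 1))"

definition permutation_poly :: "'a::finite_field poly \<Rightarrow> bool" where
  "permutation_poly f \<longleftrightarrow> bij (poly f)"

end

theory Submission
  imports Defs
begin

text \<open>
  Put \<open>y = x\<^sup>q - x\<close>. In \<open>\<Sum> (x + a) ^ (q ^ k - q - 1) = \<Sum> (x + a) ^ (q ^ k) / (x + a) ^ (q + 1)\<close> the numerator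
  is \<open>x + a + \<Sum>j<k. y ^ (q ^ j)\<close>, and partial fractions together with \<open>\<Sum> 1 / (x + a) = - 1 / y\<close> give
  \<open>g = \<Sum>2\<le>j<k. x ^ (q ^ j - q - 1) - \<Sum>1\<le>j<k. x ^ (q ^ j - 2)\<close>. For \<open>k = 2 * i\<close>, reducing exponents
  modulo \<open>q\<^sup>2 - 1\<close> collapses this to (i). For (ii), let \<open>f\<close> be the binomial and \<open>z = x ^ (q - 1)\<close>; then
  \<open>x * f x = z ^ q + z\<close> lies in the field of order \<open>q\<close>, so a nonzero value \<open>f x\<close> determines \<open>z\<close> and
  hence \<open>x\<close>, whereas \<open>f\<close> has a nonzero root if and only if \<open>z\<^sup>2 = -1\<close> for some such \<open>z\<close>, that is, if
  4 divides \<open>q + 1\<close>. Part (iii) is (i) with \<open>i = (p + 1) / 2\<close>, where \<open>i - 1 = - i\<close> in characteristic \<open>p\<close>.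
\<close>

section \<open>Characteristic, canonical map and Frobenius\<close>

lemma CHAR_finite_field_eq:
  assumes "prime p" "CARD('a::finite_field) = p ^ e"
  shows "CHAR('a) = p"
proof -
  have "CHAR('a) dvd p ^ e" using CHAR_dvd_CARD[where ?'a='a] assms(2) by simp
  then show ?thesis using assms(1) CHAR_prime[where ?'a='a]
    by (metis prime_dvd_power primes_dvd_imp_eq)
qed

lemma of_int_mod_CHAR: "of_int (x mod int CHAR('a)) = (of_int x :: 'a::ring_1)"
  by (simp add: minus_mult_div_eq_mod [symmetric])

text \<open>The prime field computes with integer representatives reduced modulo its order;
  \<open>of_int\<close> does not see this reduction when that order is the characteristic of the
  target.\<close>

lemma of_prime_field_hom:
  assumes "CHAR('a::field) = CARD('p::prime_card)"
  shows "field_hom (of_prime_field :: 'p mod_ring \<Rightarrow> 'a)"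
  using of_int_mod_CHAR[where ?'a='a]
  by unfold_locales (simp_all add: of_prime_field_def to_int_mod_ring_add to_int_mod_ring_mult flip: assms)

lemma power_char_diff:
  fixes x y :: "'a::comm_ring_1"
  assumes "prime CHAR('a)" "m = CHAR('a) ^ n"
  shows "(x - y) ^ m = x ^ m - y ^ m"
  using freshmans_dream'[OF assms, of "x - y" y] by (simp add: algebra_simps)

lemma sum_frobenius_telescope:
  fixes x :: "'a::comm_ring_1"
  assumes "prime CHAR('a)" "q = CHAR('a) ^ n"
  shows "(\<Sum>j<k. (x ^ q - x) ^ q ^ j) = x ^ q ^ k - x"
proof -
  have "(x ^ q - x) ^ q ^ j = x ^ q ^ Suc j - x ^ q ^ j" for j
    using power_char_diff[OF assms(1), of "q ^ j" "n * j" "x ^ q" x] assms(2)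
    by (simp add: power_mult)
  then show ?thesis
    using sum_lessThan_telescope[of "\<lambda>j. x ^ q ^ j" k] by simp
qed

lemma finite_field_card_gt_1: "CARD('a::finite_field) > 1"
  using card_mono[of "UNIV :: 'a set" "{0, 1}"] by simp

lemma finite_field_power_card_minus_1:
  fixes x :: "'a::finite_field"
  assumes "x \<noteq> 0"
  shows "x ^ (CARD('a) - 1) = 1"
proof -
  have "x * x ^ (CARD('a) - 1) = x * 1"
    using finite_field_power_card_eq_same[of x] by (simp flip: power_Suc)
  then show ?thesis using assms by simp
qed

section \<open>Closed form of the power sums\<close>

text \<open>Both sides have degree below q, so comparing them at the q field elements suffices;
  there every summand is 1 except the one with \<open>a = - x\<close>, which vanishes, and q - 1
  equals -1.\<close>

lemma sum_power_card_minus_one: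
  "(\<Sum>a\<in>(UNIV :: 'f::finite_field set). [:a, 1:] ^ (CARD('f) - 1)) = - 1"
proof (rule poly_eqI_degree[of UNIV])
  let ?q = "CARD('f)"
  have "?q > 1"
    by (rule finite_field_card_gt_1)
  show "poly (\<Sum>a\<in>(UNIV :: 'f set). [:a, 1:] ^ (?q - 1)) x = poly (- 1) x" for x
  proof -
    have "(\<Sum>a\<in>UNIV. (a + x) ^ (?q - 1)) = (\<Sum>a\<in>UNIV - {- x}. (1::'f))"
      using \<open>?q > 1\<close> finite_field_power_card_minus_1[where ?'a = 'f]
      by (subst sum.remove[of _ "- x"]) (auto intro!: sum.cong simp: add_eq_0_iff2)
    also have "\<dots> = of_nat (?q - 1)"
      by (simp add: card_Diff_singleton)
    also have "\<dots> = - 1"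
      using \<open>?q > 1\<close> CHAR_dvd_CARD[where ?'a='f] by (simp add: of_nat_diff of_nat_eq_0_iff_char_dvd)
    finally show ?thesis by (simp add: poly_sum)
  qed
  have "degree (\<Sum>a\<in>(UNIV :: 'f set). [:a, 1:] ^ (?q - 1)) \<le> ?q - 1"
    by (intro degree_sum_le) (auto intro: order_trans[OF degree_power_le])
  then show "degree (\<Sum>a\<in>(UNIV :: 'f set). [:a, 1:] ^ (?q - 1)) < ?q"
    using \<open>?q > 1\<close> by linarith
  show "degree (- 1 :: 'f poly) < ?q" by simp
qed

text \<open>The first sum starts at 2 because at j = 1 the exponent would be negative. The
  coefficient ring is left open, since the formula is needed over the prime field and over
  \<open>'f\<close>.\<close>

definition g_explicit :: "nat \<Rightarrow> nat \<Rightarrow> 'a::comm_ring_1 poly" where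
  "g_explicit q k = (\<Sum>j = 2..<k. monom 1 (q ^ j - q - 1)) - (\<Sum>j = 1..<k. monom 1 (q ^ j - 2))"

text \<open>Guarantees that truncated subtraction is harmless in these exponents.\<close>

lemma add_power_diff_eq_power:
  fixes q j :: nat
  assumes "q > 1" "j \<ge> 2"
  shows "q + 1 + (q ^ j - q - 1) = q ^ j"
proof -
  have "q + 1 \<le> q * 2" using assms by simp
  also have "\<dots> \<le> q ^ 2" using assms by (simp add: power2_eq_square)
  also have "\<dots> \<le> q ^ j" using assms by (intro power_increasing) auto
  finally have "q + 1 \<le> q ^ j" .
  then show ?thesis by simp
qed

lemma degree_monom_diff_monom:
  "k < m \<Longrightarrow> degree (monom 1 m - monom 1 k :: 'a::comm_ring_1 poly) = m"
  using degree_add_eq_left[of "- monom 1 k" "monom 1 m :: 'a poly"] by (simp add: degree_monom_eq)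

text \<open>With \<open>L = x + a\<close>, \<open>y = x\<^sup>q - x\<close> and \<open>c = y / L\<close>, the relation \<open>L\<^sup>q = L + y\<close> yields the partial
  fractions \<open>c ^ (q + 1) = y ^ (q - 1) * c - c ^ q\<close>, while \<open>L ^ (q ^ k) - L\<close> does not depend on \<open>a\<close>.
  Hence everything reduces to the sum of the \<open>c\<close>, which is \<open>-1\<close>.\<close>

lemma sum_power_eq_pcompose:
  fixes q k :: nat
  defines "q \<equiv> CARD('f::finite_field)"
  assumes q: "q = CHAR('f) ^ n" and k: "k \<ge> 2"
  shows "(\<Sum>a\<in>(UNIV :: 'f set). [:a, 1:] ^ (q ^ k - q - 1)) =
    pcompose (g_explicit q k) (monom 1 q - monom 1 1)"
proof -
  define y :: "'f poly" where "y = monom 1 q - monom 1 1"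
  define L :: "'f \<Rightarrow> 'f poly" where "L a = [:a, 1:]" for a
  \<comment> \<open>\<open>c a\<close> is the quotient y / L in polynomial form, so that the
    computation stays free of fractions.\<close>
  define c :: "'f \<Rightarrow> 'f poly" where "c a = L a ^ (q - 1) - 1" for a
  define T where "T = (\<Sum>j<k. y ^ q ^ j)"
  have q1: "q > 1"
    unfolding q_def by (rule finite_field_card_gt_1)
  have prime_char: "prime CHAR('f poly)" and q': "q = CHAR('f poly) ^ n"
    using q by simp_all
  have power_X: "monom 1 1 ^ m = (monom 1 m :: 'f poly)" for m
    by (simp add: monom_power)
  have L: "L a = monom 1 1 + [:a:]" for a
    by (simp add: L_def monom_altdef)
  have Lq: "L a ^ q = L a + y" for a
  proof -
    have "L a ^ q = monom 1 q + [:a:] ^ q"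
      unfolding L freshmans_dream'[OF prime_char q'] power_X ..
    also have "[:a:] ^ q = [:a:]"
      using finite_field_power_card_eq_same[of a] by (simp add: q_def poly_const_pow)
    finally show ?thesis by (simp add: L y_def)
  qed
  have Lc: "L a * c a = y" for a
    using Lq[of a] q1 by (simp add: c_def algebra_simps power_eq_if)
  have "degree y = q"
    unfolding y_def using q1 by (rule degree_monom_diff_monom)
  with q1 have y0: "y \<noteq> 0" by auto
  have T: "L a ^ q ^ k = L a + T" for a
    using sum_frobenius_telescope[OF prime_char q', of "L a" k] Lq[of a] by (simp add: T_def algebra_simps)
  have sum_c: "(\<Sum>a\<in>UNIV. c a) = - 1"
  proof -
    have "of_nat q = (0 :: 'f poly)"
      using CHAR_dvd_CARD[where ?'a='f] by (simp add: of_nat_eq_0_iff_char_dvd q_def)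
    then show ?thesis
      using sum_power_card_minus_one[where ?'f='f]
      by (simp add: c_def L_def sum_subtractf flip: q_def)
  qed
  have sum_cq: "(\<Sum>a\<in>UNIV. c a ^ q) = - 1"
  proof -
    \<comment> \<open>Writing -1 as 0 - 1 lets Frobenius give \<open>(- 1) ^ q = - 1\<close> for
      even q as well.\<close>
    have "(\<Sum>a\<in>UNIV. c a ^ q) = (0 - 1) ^ q"
      using freshmans_dream_sum'[OF prime_char q', of c UNIV] sum_c by simp
    also have "\<dots> = - 1"
      using q1 by (subst power_char_diff[OF prime_char q']) (simp add: power_0_left)
    finally show ?thesis .
  qed
  have c_power: "c a ^ (q + 1) = y ^ (q - 1) * c a - c a ^ q" for a
  proof -
    \<comment> \<open>Raise \<open>L a * c a = y\<close> to the power q, replace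
      \<open>L a ^ q\<close> by \<open>L a + y\<close> and cancel one factor y; multiplying by
      \<open>c a\<close> then gives the claim.\<close>
    have "y * y ^ (q - 1) = (L a * c a) ^ q"
      using q1 by (simp add: Lc flip: power_Suc)
    also have "\<dots> = (L a + y) * c a ^ q"
      by (simp add: power_mult_distrib Lq)
    also have "\<dots> = L a * c a * c a ^ (q - 1) + y * c a ^ q"
      using q1 by (simp add: algebra_simps flip: power_Suc)
    also have "\<dots> = y * (c a ^ (q - 1) + c a ^ q)"
      by (simp add: Lc algebra_simps)
    finally have "y ^ (q - 1) = c a ^ (q - 1) + c a ^ q"
      using y0 by simp
    then show ?thesis
      using q1 by (simp add: algebra_simps flip: power_Suc)
  qed
  have sum_c_power: "(\<Sum>a\<in>UNIV. c a ^ (q + 1)) = 1 - y ^ (q - 1)"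
    unfolding c_power sum_subtractf sum_distrib_left [symmetric] sum_c sum_cq by simp
  \<comment> \<open>The factor \<open>y ^ (q + 1)\<close> supplies the missing
    \<open>L a ^ (q + 1)\<close>, which completes the exponent to \<open>q ^ k\<close>.\<close>
  have step: "y ^ (q + 1) * L a ^ (q ^ k - q - 1) = y * c a ^ q + T * c a ^ (q + 1)" for a
  proof -
    have "y ^ (q + 1) * L a ^ (q ^ k - q - 1) = L a ^ (q + 1 + (q ^ k - q - 1)) * c a ^ (q + 1)"
      unfolding Lc[of a, symmetric] power_mult_distrib power_add by (simp only: mult_ac)
    also have "\<dots> = (L a + T) * c a ^ (q + 1)"
      unfolding add_power_diff_eq_power[OF q1 k] T ..
    also have "\<dots> = L a * c a * c a ^ q + T * c a ^ (q + 1)"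
      by (simp add: algebra_simps)
    finally show ?thesis by (simp add: Lc)
  qed
  \<comment> \<open>The first form serves \<open>T - y\<close>, the second
    \<open>T * y ^ (q - 1)\<close>; each yields a term \<open>y ^ q\<close>, and these
    cancel.\<close>
  have split: "T = y + y ^ q + (\<Sum>j=2..<k. y ^ q ^ j)" "T = y + (\<Sum>j=1..<k. y ^ q ^ j)"
    using k by (simp_all add: T_def lessThan_atLeast0 sum.atLeast_Suc_lessThan numeral_2_eq_2)
  have "y ^ (q + 1) * (\<Sum>a\<in>UNIV. L a ^ (q ^ k - q - 1)) = - y + T * (1 - y ^ (q - 1))"
    unfolding sum_distrib_left step sum.distrib
    unfolding sum_distrib_left [symmetric] sum_cq sum_c_power by simp
  also have "\<dots> = (T - y) - T * y ^ (q - 1)"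
    by (simp add: algebra_simps)
  also have "\<dots> = (y ^ q + (\<Sum>j=2..<k. y ^ q ^ j)) - (y ^ q + (\<Sum>j=1..<k. y ^ q ^ j * y ^ (q - 1)))"
    using q1 by (subst split(1), subst split(2)) (simp add: distrib_right sum_distrib_right flip: power_Suc)
  also have "\<dots> = (\<Sum>j=2..<k. y ^ q ^ j) - (\<Sum>j=1..<k. y ^ q ^ j * y ^ (q - 1))"
    by simp
  also have "(\<Sum>j=2..<k. y ^ q ^ j) = y ^ (q + 1) * (\<Sum>j=2..<k. y ^ (q ^ j - q - 1))"
  proof -
    have "y ^ q ^ j = y ^ (q + 1) * y ^ (q ^ j - q - 1)" if "j \<ge> 2" for j
      unfolding power_add[symmetric] add_power_diff_eq_power[OF q1 that] ..
    then show ?thesis by (simp add: sum_distrib_left)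
  qed
  also have "(\<Sum>j=1..<k. y ^ q ^ j * y ^ (q - 1)) = y ^ (q + 1) * (\<Sum>j=1..<k. y ^ (q ^ j - 2))"
  proof -
    have "y ^ q ^ j * y ^ (q - 1) = y ^ (q + 1) * y ^ (q ^ j - 2)" if "j \<ge> 1" for j
    proof -
      have "q ^ j \<ge> q ^ 1" using that q1 by (intro power_increasing) auto
      then have "q ^ j + (q - 1) = q + 1 + (q ^ j - 2)" using q1 by simp
      then show ?thesis unfolding power_add[symmetric] by simp
    qed
    then show ?thesis by (simp add: sum_distrib_left)
  qed
  also have "y ^ (q + 1) * (\<Sum>j=2..<k. y ^ (q ^ j - q - 1)) - y ^ (q + 1) * (\<Sum>j=1..<k. y ^ (q ^ j - 2))
    = y ^ (q + 1) * pcompose (g_explicit q k) y"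
  proof -
    have "pcompose (monom 1 m) y = y ^ m" for m
      by (induction m) (simp_all add: monom_Suc pcompose_pCons)
    then show ?thesis
      by (simp add: g_explicit_def pcompose_diff pcompose_sum right_diff_distrib)
  qed
  finally show ?thesis
    using y0 by (simp add: L_def y_def)
qed

section \<open>Reduction of exponents modulo q^2 - 1\<close>

text \<open>Each increment of t trades one factor x for \<open>x ^ m\<close>;
  \<open>k \<ge> 1\<close> ensures that such a factor is present.\<close>

lemma monom_cong_mod_monom_minus_X:
  fixes k m t :: nat
  assumes "k \<ge> 1" "m \<ge> 1"
  shows "[monom 1 (k + t * (m - 1)) = (monom 1 k :: 'a::field_gcd poly)] (mod (monom 1 m - monom 1 1))"
proof -
  obtain k' m' where k: "k = Suc k'" and m: "m = Suc m'"
    using assms by (metis Suc_le_D One_nat_def)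
  show ?thesis
  proof (induction t)
    case (Suc t)
    have "monom 1 (k + Suc t * m') - monom 1 (k + t * m') =
        monom 1 (k' + t * m') * (monom 1 m - monom 1 1 :: 'a poly)"
      by (simp add: k m right_diff_distrib mult_monom algebra_simps)
    then have "[monom 1 (k + Suc t * m') = (monom 1 (k + t * m') :: 'a poly)]
        (mod (monom 1 m - monom 1 1))"
      by (simp add: cong_iff_dvd_diff)
    with Suc show ?case
      by (auto simp: m intro: cong_trans)
  qed simp
qed

text \<open>The induction step adds the indices 2 i and 2 i + 1. Their four exponents reduce to q^2
  - q - 1, q^2 - 2, q^2 - 2 and q - 2, and the two monomials of exponent q^2 - 2 cancel. The bound q
  > 2 keeps q - 2 positive.\<close>

lemma g_explicit_cong:
  fixes q i :: nat
  assumes "q > 2" "i \<ge> 1"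
  shows "[g_explicit q (2 * i) =
      smult (of_nat i - 1) (monom 1 (q\<^sup>2 - q - 1)) - smult (of_nat i) (monom 1 (q - 2))]
    (mod (monom 1 (q\<^sup>2) - monom 1 1 :: 'a::field_gcd poly))"
  using assms(2)
proof (induction i rule: nat_induct_at_least)
  case base
  have "{1..<2} = {1 :: nat}" by auto
  then show ?case by (simp add: g_explicit_def)
next
  case (Suc i)
  let ?X = "\<lambda>m. monom 1 m :: 'a poly"
  have qq: "q\<^sup>2 \<ge> 3 * q"
    using assms(1) by (simp add: power2_eq_square)
  define d where "d = q\<^sup>2 - 1"
  have d: "q\<^sup>2 = 1 + d"
    using qq assms(1) by (simp add: d_def)
  have "\<exists>s. q ^ (2 * j) = 1 + s * d" for j
  proof (induction j)
    case (Suc j)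
    then obtain s where "q ^ (2 * j) = 1 + s * d" by blast
    moreover have "q ^ (2 * Suc j) = q ^ (2 * j) * q\<^sup>2"
      by (simp flip: power_add)
    ultimately have "q ^ (2 * Suc j) = (1 + s * d) * (1 + d)"
      by (simp only: d)
    also have "\<dots> = 1 + (1 + s + s * d) * d"
      by (simp add: algebra_simps)
    finally show ?case by blast
  qed auto
  \<comment> \<open>Taken at \<open>i - 1\<close>, so that q^2 splits off from
    \<open>q ^ (2 * i)\<close> and the later subtractions leave positive exponents.\<close>
  then obtain s where s: "q ^ (2 * (i - 1)) = 1 + s * d" by blast
  have even_power: "q ^ (2 * i) = q\<^sup>2 + s * q\<^sup>2 * d"
  proof -
    have "2 * i = 2 * (i - 1) + 2"
      using Suc.hyps by simp
    then have "q ^ (2 * i) = q ^ (2 * (i - 1)) * q\<^sup>2"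
      by (metis power_add)
    then have "q ^ (2 * i) = (1 + s * d) * q\<^sup>2"
      by (simp only: s)
    then show ?thesis by (simp add: algebra_simps)
  qed
  have odd_power: "q ^ (2 * i + 1) = q + (1 + s * q\<^sup>2) * q * d"
  proof -
    have "q ^ (2 * i + 1) = (1 + d + s * q\<^sup>2 * d) * q"
      using even_power by (simp add: d)
    then show ?thesis by (simp add: algebra_simps)
  qed
  have *: "[?X e = ?X f] (mod (?X (q\<^sup>2) - ?X 1))" if "e = f + t * d" "f \<ge> 1" for e f t
    using monom_cong_mod_monom_minus_X[of f "q\<^sup>2" t] that qq assms(1) by (simp add: d_def)
  have 1: "[?X (q ^ (2 * i) - q - 1) = ?X (q\<^sup>2 - q - 1)] (mod (?X (q\<^sup>2) - ?X 1))"
    by (rule *[where t = "s * q\<^sup>2"]) (use even_power qq assms(1) in auto)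
  have 2: "[?X (q ^ (2 * i) - 2) = ?X (q\<^sup>2 - 2)] (mod (?X (q\<^sup>2) - ?X 1))"
    by (rule *[where t = "s * q\<^sup>2"]) (use even_power qq assms(1) in auto)
  have 3: "[?X (q ^ (2 * i + 1) - 2) = ?X (q - 2)] (mod (?X (q\<^sup>2) - ?X 1))"
    by (rule *[where t = "(1 + s * q\<^sup>2) * q"]) (use odd_power assms(1) in auto)
  \<comment> \<open>Here only q splits off, too little for subtracting q + 1, so one copy of d is
    borrowed: -1 + d = q^2 - 2.\<close>
  have 4: "[?X (q ^ (2 * i + 1) - q - 1) = ?X (q\<^sup>2 - 2)] (mod (?X (q\<^sup>2) - ?X 1))"
  proof (rule *[where t = "(1 + s * q\<^sup>2) * q - 1"])
    have "(1 + s * q\<^sup>2) * q > 0"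
      using assms(1) by simp
    then have "(1 + s * q\<^sup>2) * q * d = d + ((1 + s * q\<^sup>2) * q - 1) * d"
      by (cases "(1 + s * q\<^sup>2) * q") simp_all
    then show "q ^ (2 * i + 1) - q - 1 = q\<^sup>2 - 2 + ((1 + s * q\<^sup>2) * q - 1) * d"
      using odd_power qq assms(1) d by linarith
  qed (use qq assms(1) in auto)
  have "g_explicit q (2 * Suc i) = g_explicit q (2 * i)
      + ?X (q ^ (2 * i) - q - 1) + ?X (q ^ (2 * i + 1) - q - 1)
      - ?X (q ^ (2 * i) - 2) - ?X (q ^ (2 * i + 1) - 2)"
    using Suc.hyps by (simp add: g_explicit_def)
  also have "[\<dots> = (smult (of_nat i - 1) (?X (q\<^sup>2 - q - 1)) - smult (of_nat i) (?X (q - 2)))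
      + ?X (q\<^sup>2 - q - 1) + ?X (q\<^sup>2 - 2) - ?X (q\<^sup>2 - 2) - ?X (q - 2)] (mod (?X (q\<^sup>2) - ?X 1))"
    by (intro cong_add cong_diff Suc.IH 1 2 3 4)
  also have "(smult (of_nat i - 1) (?X (q\<^sup>2 - q - 1)) - smult (of_nat i) (?X (q - 2)))
      + ?X (q\<^sup>2 - q - 1) + ?X (q\<^sup>2 - 2) - ?X (q\<^sup>2 - 2) - ?X (q - 2) =
      smult (of_nat (Suc i) - 1) (?X (q\<^sup>2 - q - 1)) - smult (of_nat (Suc i)) (?X (q - 2))"
    by (simp add: algebra_simps smult_add_left smult_diff_left)
  finally show ?case .
qed

section \<open>The binomial on the field of order q^2\<close>

text \<open>Otherwise all nonzero elements would be roots of X^h - 1, where h is only half their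
  number.\<close>

lemma ex_power_half_card_eq_minus_1:
  assumes "odd CARD('a::finite_field)"
  shows "\<exists>w :: 'a. w ^ ((CARD('a) - 1) div 2) = - 1"
proof (rule ccontr)
  let ?h = "(CARD('a) - 1) div 2"
  assume *: "\<nexists>w :: 'a. w ^ ?h = - 1"
  have "CARD('a) > 1"
    by (rule finite_field_card_gt_1)
  with assms have h: "?h > 0" "2 * ?h = CARD('a) - 1"
    by (auto elim!: oddE)
  have "w ^ ?h = 1" if "w \<noteq> 0" for w :: 'a
  proof -
    have "(w ^ ?h)\<^sup>2 = 1"
      using finite_field_power_card_minus_1[OF that] h(2) by (simp flip: power_mult add: mult.commute)
    then show ?thesis
      using * by (auto simp: power2_eq_1_iff)
  qed
  then have "card (UNIV - {0 :: 'a}) \<le> card {w :: 'a. poly (monom 1 ?h - 1) w = 0}"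
    by (intro card_mono) (auto simp: poly_monom)
  also have "degree (monom 1 ?h - 1 :: 'a poly) = ?h"
    using degree_monom_diff_monom[OF h(1)] by (simp add: monom_0 one_pCons)
  then have "card {w :: 'a. poly (monom 1 ?h - 1) w = 0} \<le> ?h"
    using h card_poly_roots_bound[of "monom 1 ?h - 1 :: 'a poly"] by fastforce
  finally show False
    using h by (simp add: card_Diff_singleton)
qed

lemma permutation_poly_binomial_iff:
  fixes q :: nat
  assumes card: "CARD('k::finite_field) = q\<^sup>2" and q: "q = CHAR('k) ^ n" "odd q" "q > 1"
  shows "permutation_poly (monom 1 (q\<^sup>2 - q - 1) + monom 1 (q - 2) :: 'k poly) \<longleftrightarrow> [q = 1] (mod 4)"
proof -
  define f where "f x = x ^ (q\<^sup>2 - q - 1) + x ^ (q - 2)" for x :: 'k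
  have q3: "q \<ge> 3"
    using q(2,3) by (cases "q = 2") auto
  have qq: "q\<^sup>2 \<ge> 3 * q"
    using q3 by (simp add: power2_eq_square)
  have "permutation_poly (monom 1 (q\<^sup>2 - q - 1) + monom 1 (q - 2) :: 'k poly) \<longleftrightarrow> bij f"
  proof -
    have "poly (monom 1 (q\<^sup>2 - q - 1) + monom 1 (q - 2)) = f"
      by (rule ext) (simp add: f_def poly_monom)
    then show ?thesis by (simp add: permutation_poly_def)
  qed
  also have "\<dots> \<longleftrightarrow> inj f"
    using finite_UNIV_inj_surj[of f] by (auto simp: bij_def)
  also have "inj f \<longleftrightarrow> [q = 1] (mod 4)"
  proof
    have f0: "f 0 = 0"
      using q3 qq by (simp add: f_def power_0_left)
    \<comment> \<open>With z = x^(q - 1), the right-hand side is the trace of z to the subfield of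
      order q; the fact \<open>z\<close> below says that z has norm 1 for nonzero x.\<close>
    have xf: "x * f x = (x ^ (q - 1)) ^ q + x ^ (q - 1)" for x
    proof -
      have "x * x ^ (q\<^sup>2 - q - 1) = x ^ ((q - 1) * q)"
      proof -
        have "(q - 1) * q = q\<^sup>2 - q"
          by (simp add: diff_mult_distrib power2_eq_square)
        also have "\<dots> = Suc (q\<^sup>2 - q - 1)"
          using q3 qq by linarith
        finally show ?thesis by simp
      qed
      moreover have "x * x ^ (q - 2) = x ^ (q - 1)"
        using q3 by (simp add: numeral_2_eq_2 Suc_diff_Suc flip: power_Suc)
      ultimately show ?thesis
        by (simp add: f_def distrib_left power_mult)
    qed
    have z: "(x ^ (q - 1)) ^ (q + 1) = 1" if "x \<noteq> 0" for x :: 'k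
    proof -
      have "(q - 1) * (q + 1) = CARD('k) - 1"
        unfolding card by (simp add: algebra_simps power2_eq_square)
      then show ?thesis
        using finite_field_power_card_minus_1[OF that] by (simp only: power_mult [symmetric])
    qed
    show "[q = 1] (mod 4)" if "inj f"
    proof (rule ccontr)
      assume "\<not> [q = 1] (mod 4)"
      with q(2) have "q mod 4 = 3"
        unfolding cong_def by presburger
      then obtain m where m: "q = 4 * m + 3"
        by (metis mult.commute mult_div_mod_eq)
      obtain w :: 'k where w: "w ^ ((CARD('k) - 1) div 2) = - 1"
        using ex_power_half_card_eq_minus_1[where ?'a='k] card q(2) by auto
      \<comment> \<open>Since q + 1 = 4 (m + 1), half of q^2 - 1 is 2 (m + 1) (q - 1), so
        \<open>x ^ (q - 1)\<close> is a square root of -1. As q is 3 modulo 4, its trace vanishes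
        and x is a nonzero root of f.\<close>
      define x where "x = w ^ (m + 1)"
      have "(CARD('k) - 1) div 2 = (m + 1) * ((q - 1) * 2)"
        unfolding card m by (simp add: power2_eq_square algebra_simps)
      then have sq: "(x ^ (q - 1))\<^sup>2 = - 1"
        using w by (simp only: x_def power_mult)
      then have "x \<noteq> 0"
        using q3 by (auto simp: power_0_left)
      have "(x ^ (q - 1)) ^ q = ((x ^ (q - 1))\<^sup>2) ^ (2 * m + 1) * x ^ (q - 1)"
      proof -
        have "q = 2 * (2 * m + 1) + 1"
          using m by simp
        then show ?thesis
          by (metis power_add power_mult power_one_right)
      qed
      also have "\<dots> = - (x ^ (q - 1))"
        unfolding sq by simp
      finally have "x * f x = 0"
        by (simp add: xf)
      with \<open>x \<noteq> 0\<close> have "f x = f 0"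
        by (simp add: f0)
      with \<open>x \<noteq> 0\<close> show False
        using that by (auto dest: injD)
    qed
    show "inj f" if "[q = 1] (mod 4)"
    proof -
      have "q mod 4 = 1"
        using that by (simp add: cong_def)
      then have "q = 4 * (q div 4) + 1"
        by presburger
      then obtain m where m: "q = 4 * m + 1"
        by blast
      \<comment> \<open>A nonzero root gives z^q = -z, hence z^2 = -1 by the norm condition; but
        then q = 1 modulo 4 forces z^q = z, so 2 z = 0, impossible in odd characteristic.\<close>
      have f_eq_0: "x = 0" if "f x = 0" for x
      proof (rule ccontr)
        assume "x \<noteq> 0"
        define z where "z = x ^ (q - 1)"
        have "z \<noteq> 0"
          using \<open>x \<noteq> 0\<close> by (simp add: z_def)
        have "z ^ q = - z"
          using xf[of x] that by (simp add: z_def eq_neg_iff_add_eq_0)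
        moreover have "z ^ q * z = 1"
          using z[OF \<open>x \<noteq> 0\<close>] by (simp add: z_def mult.commute)
        ultimately have "z\<^sup>2 = - 1"
          by (simp add: power2_eq_square minus_equation_iff)
        moreover have "z ^ q = (z\<^sup>2) ^ (2 * m) * z"
          unfolding m by (simp flip: power_mult)
        ultimately have "z ^ q = z"
          by (simp only: power_mult) simp
        then have "2 * z = 0"
          using \<open>z ^ q = - z\<close> by (simp add: eq_neg_iff_add_eq_0)
        moreover have "(2 :: 'k) \<noteq> 0"
        proof
          assume "(2 :: 'k) = 0"
          then have "CHAR('k) dvd 2"
            using of_nat_eq_0_iff_char_dvd[where ?'a='k, of 2] by simp
          then have "CHAR('k) = 2"
            using CHAR_prime[where ?'a='k] by (metis primes_dvd_imp_eq two_is_prime_nat)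
          then show False
            using q by (cases n) auto
        qed
        ultimately show False
          using \<open>z \<noteq> 0\<close> by simp
      qed
      \<comment> \<open>\<open>x * f x\<close> is a trace, hence fixed by the q-th power map, so its
        power q - 1 is 1. Thus a nonzero value \<open>f x\<close> determines
        \<open>x ^ (q - 1)\<close>, then \<open>x * f x\<close> by \<open>xf\<close>, and finally
        x.\<close>
      have zc: "x ^ (q - 1) * f x ^ (q - 1) = 1" if "f x \<noteq> 0" for x
      proof -
        define z where "z = x ^ (q - 1)"
        have "x \<noteq> 0"
          using that f0 by auto
        have "z ^ (q * q) = z"
          using finite_field_power_card_eq_same[of z] card by (simp add: power2_eq_square)
        then have "(z ^ q + z) ^ q = z ^ q + z"
          using q(1) by (subst freshmans_dream'[where n = n]) (simp_all add: add.commute flip: power_mult)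
        then have "(x * f x) ^ q = x * f x"
          by (simp add: xf z_def)
        then have "(x * f x) * (x * f x) ^ (q - 1) = (x * f x) * 1"
          using q3 by (simp flip: power_Suc)
        then show ?thesis
          using that \<open>x \<noteq> 0\<close> by (simp add: power_mult_distrib)
      qed
      show "inj f"
      proof
        fix x y
        assume eq: "f x = f y"
        show "x = y"
        proof (cases "f x = 0")
          case True
          then show ?thesis using eq f_eq_0[of x] f_eq_0[of y] by simp
        next
          case False
          then have "x ^ (q - 1) = y ^ (q - 1)"
            using zc[of x] zc[of y] eq by (metis mult_cancel_right zero_neq_one mult_zero_right)
          then have "x * f x = y * f x"
            using xf[of x] xf[of y] eq by simp
          then show ?thesis using False by simp
        qed
      qed
    qed
  qed
  finally show ?thesis .
qed

section \<open>Identification of g and its values on the larger field\<close>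

text \<open>Lifting coefficients is injective, and so is composition with the nonconstant x^q - x;
  hence the closed form is the only solution of the defining identity.\<close>

lemma g_poly_eq_g_explicit:
  assumes char: "CHAR('f::finite_field) = CARD('p::prime_card)"
    and card: "CARD('f) = CHAR('f) ^ n" and k: "k \<ge> 2"
  shows "(g_poly TYPE('f) (CARD('f) ^ k - CARD('f) - 1) :: 'p mod_ring poly) = g_explicit CARD('f) k"
proof -
  let ?q = "CARD('f)"
  interpret field_hom "of_prime_field :: 'p mod_ring \<Rightarrow> 'f"
    by (rule of_prime_field_hom) (fact char)
  interpret lift: map_poly_inj_idom_hom "of_prime_field :: 'p mod_ring \<Rightarrow> 'f" ..
  have "?q > 1"
    by (rule finite_field_card_gt_1)
  then have deg: "degree (monom 1 ?q - monom 1 1 :: 'f poly) > 0"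
    by (simp only: degree_monom_diff_monom)
  have lift: "lift_poly (g_explicit ?q k :: 'p mod_ring poly) = (g_explicit ?q k :: 'f poly)"
    by (simp add: g_explicit_def hom_distribs)
  note sum = sum_power_eq_pcompose[OF card k]
  show ?thesis
    unfolding g_poly_def
  proof (rule the_equality)
    fix g :: "'p mod_ring poly"
    assume "(\<Sum>a\<in>(UNIV :: 'f set). [:a, 1:] ^ (?q ^ k - ?q - 1)) =
      pcompose (lift_poly g) (monom 1 ?q - monom 1 1)"
    with sum have "pcompose (lift_poly g - g_explicit ?q k) (monom 1 ?q - monom 1 1 :: 'f poly) = 0"
      by (simp add: pcompose_diff)
    then have "lift_poly g - g_explicit ?q k = (0 :: 'f poly)"
      using deg by (rule pcompose_eq_0)
    then have "lift_poly g = (lift_poly (g_explicit ?q k :: 'p mod_ring poly) :: 'f poly)"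
      by (simp add: lift)
    then show "g = g_explicit ?q k"
      by (simp only: lift.eq_iff)
  qed (use sum lift in simp)
qed

text \<open>The lifted modulus vanishes at every element of \<open>'k\<close>.\<close>

lemma poly_lift_eq_of_cong:
  fixes g h :: "'p::prime_card mod_ring poly" and x :: "'k::finite_field"
  assumes char: "CHAR('k) = CARD('p)"
    and cong: "[g = h] (mod (monom 1 CARD('k) - monom 1 1))"
  shows "poly (lift_poly g) x = poly (lift_poly h) x"
proof -
  interpret field_hom "of_prime_field :: 'p mod_ring \<Rightarrow> 'k"
    by (rule of_prime_field_hom) (fact char)
  interpret lift: map_poly_inj_idom_hom "of_prime_field :: 'p mod_ring \<Rightarrow> 'k" ..
  obtain r where "g - h = (monom 1 CARD('k) - monom 1 1) * r"
    using cong unfolding cong_iff_dvd_diff dvd_def by blast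
  then have "lift_poly (g - h) = (lift_poly ((monom 1 CARD('k) - monom 1 1) * r) :: 'k poly)"
    by simp
  then have "lift_poly g - lift_poly h = (monom 1 CARD('k) - monom 1 1) * (lift_poly r :: 'k poly)"
    by (simp add: hom_distribs)
  then have "poly (lift_poly g - lift_poly h) x = (x ^ CARD('k) - x) * poly (lift_poly r) x"
    by (simp add: poly_monom)
  then show ?thesis
    by (simp add: finite_field_power_card_eq_same)
qed

lemma permutation_poly_smult:
  assumes "c \<noteq> 0"
  shows "permutation_poly (smult c f) \<longleftrightarrow> permutation_poly f"
proof -
  have "bij_betw ((*) c) UNIV UNIV"
    using assms by (intro bij_betwI[of _ _ _ "\<lambda>x. x / c"]) auto
  then have "bij (poly f) \<longleftrightarrow> bij ((*) c \<circ> poly f)"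
    by (rule bij_betw_comp_iff2) simp
  moreover have "(*) c \<circ> poly f = poly (smult c f)"
    by auto
  ultimately show ?thesis
    by (simp add: permutation_poly_def)
qed

theorem theorem5p10:
  fixes p q e :: nat
  assumes "prime p" and "CARD('p::prime_card) = p" and "q = p ^ e" and "e \<ge> 1"
  shows
    "(CARD('f::finite_field) = q \<longrightarrow>
        (\<forall>i::nat. q > 2 \<and> i \<ge> 1 \<longrightarrow>
          [(g_poly TYPE('f) (q ^ (2 * i) - q - 1) :: 'p mod_ring poly) =
             smult (of_nat i - 1) (monom 1 (q\<^sup>2 - q - 1)) - smult (of_nat i) (monom 1 (q - 2))]
          (mod (monom 1 (q\<^sup>2) - monom 1 1))))
     \<and> (CARD('k::finite_field) = q\<^sup>2 \<longrightarrow> odd q \<longrightarrow>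
        (permutation_poly (monom 1 (q\<^sup>2 - q - 1) + monom 1 (q - 2) :: 'k poly)
           \<longleftrightarrow> [q = 1] (mod 4)))
     \<and> (CARD('f) = q \<longrightarrow> CARD('k) = q\<^sup>2 \<longrightarrow> odd q \<longrightarrow>
        (permutation_poly
             (lift_poly (g_poly TYPE('f) (q ^ (p + 1) - q - 1) :: 'p mod_ring poly) :: 'k poly)
           \<longleftrightarrow> [q = 1] (mod 4)))"
proof -
  have q1: "q > 1"
    using one_less_power[OF prime_gt_1_nat[OF assms(1)], of e] assms(3,4) by simp
  have char_f: "CHAR('f) = CARD('p)" if "CARD('f) = q"
    using CHAR_finite_field_eq[OF assms(1)] that assms(2,3) by metis
  have char_k: "CHAR('k) = CARD('p)" if "CARD('k) = q\<^sup>2"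
    using CHAR_finite_field_eq[of p "e * 2", where ?'a='k] that assms(1-3) by (simp add: power_mult)
  have g: "(g_poly TYPE('f) (q ^ (2 * i) - q - 1) :: 'p mod_ring poly) = g_explicit q (2 * i)"
    if "CARD('f) = q" "i \<ge> 1" for i
    using g_poly_eq_g_explicit[OF char_f[OF that(1)], of e "2 * i"] that assms(2,3) char_f
    by simp
  have binomial: "permutation_poly (monom 1 (q\<^sup>2 - q - 1) + monom 1 (q - 2) :: 'k poly) \<longleftrightarrow> [q = 1] (mod 4)"
    if "CARD('k) = q\<^sup>2" "odd q"
    using permutation_poly_binomial_iff[OF that(1) _ that(2) q1] char_k[OF that(1)] assms(2,3) by metis
  have "permutation_poly
       (lift_poly (g_poly TYPE('f) (q ^ (p + 1) - q - 1) :: 'p mod_ring poly) :: 'k poly)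
     \<longleftrightarrow> [q = 1] (mod 4)"
    if card: "CARD('f) = q" "CARD('k) = q\<^sup>2" and "odd q"
  proof -
    interpret field_hom "of_prime_field :: 'p mod_ring \<Rightarrow> 'k"
      by (rule of_prime_field_hom) (fact char_k[OF card(2)])
    interpret lift: map_poly_inj_idom_hom "of_prime_field :: 'p mod_ring \<Rightarrow> 'k" ..
    have "odd p"
      using \<open>odd q\<close> assms(3,4) by auto
    then obtain m where m: "p + 1 = 2 * (m + 1)"
      by (auto elim!: oddE)
    have "q > 2"
      using q1 \<open>odd q\<close> by (cases "q = 2") auto
    \<comment> \<open>u is the image of i = (p + 1) / 2, an inverse of 2 in characteristic p; hence
      i - 1 and -i both become -u.\<close>
    define u :: 'k where "u = of_nat (m + 1)"
    have "2 * u = of_nat (p + 1)"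
      unfolding u_def m by simp
    also have "\<dots> = 1"
      using char_k[OF card(2)] assms(2) by (simp add: of_nat_eq_0_iff_char_dvd)
    finally have u: "u - 1 = - u" "u \<noteq> 0"
      by (auto simp: algebra_simps)
    let ?h = "smult (of_nat (m + 1) - 1) (monom 1 (q\<^sup>2 - q - 1)) -
      smult (of_nat (m + 1)) (monom 1 (q - 2)) :: 'p mod_ring poly"
    let ?g = "g_poly TYPE('f) (q ^ (p + 1) - q - 1) :: 'p mod_ring poly"
    have "lift_poly ?h = smult (u - 1) (monom 1 (q\<^sup>2 - q - 1)) - smult u (monom 1 (q - 2))"
      unfolding u_def by (simp only: hom_distribs map_poly_hom_monom hom_one)
    then have h: "lift_poly ?h = smult (- u) (monom 1 (q\<^sup>2 - q - 1) + monom 1 (q - 2))"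
      by (simp add: u(1) smult_add_right)
    have "[?g = ?h] (mod (monom 1 CARD('k) - monom 1 1))"
      unfolding m g[OF card(1) le_add2] card(2)
      using \<open>q > 2\<close> by (rule g_explicit_cong) simp
    then have "poly (lift_poly ?g) = poly (lift_poly ?h :: 'k poly)"
      using poly_lift_eq_of_cong[OF char_k[OF card(2)]] by blast
    then have "permutation_poly (lift_poly ?g :: 'k poly) \<longleftrightarrow> permutation_poly (lift_poly ?h :: 'k poly)"
      by (simp add: permutation_poly_def)
    then show ?thesis
      using u(2) binomial[OF card(2) \<open>odd q\<close>] unfolding h by (subst (asm) permutation_poly_smult) simp_all
  qed
  then show ?thesis
    using g binomial g_explicit_cong by auto
qed

end
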